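(* Let $\mathcal{A}$ be a downset in $\mathcal{B}(n)$, and let $\mathcal{I}$ be the set of the first $|\mathcal{A}|$ elements of the level-colex order on $\mathcal{B}(n)$. Then $m(\mathcal{A}) \le m(\mathcal{I})$.
   Context: $\mathcal{B}(n)$ is the Boolean lattice of all subsets of $[n]=\{1,\dots,n\}$ ordered by inclusion. A downset is a family $\mathcal{D}$ such that $X \in \mathcal{D}$ and $Y \subseteq X$ imply $Y \in \mathcal{D}$. For a downset $\mathcal{D}$, $m(\mathcal{D})$ denotes the number of inclusion-maximal elements of $\mathcal{D}$. The level-colex order on $\mathcal{B}(n)$ is the total order with $A<B$ if either $|A|<|B|$, or $|A|=|B|$ and $\max(A \triangle B) \in B$. *)

theory Defs
  imports Main
begin

definition boolean_lattice :: "nat \<Rightarrow> nat set set" where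
  "boolean_lattice n = Pow {1..n}"

definition downset :: "nat \<Rightarrow> nat set set \<Rightarrow> bool" where
  "downset n D \<longleftrightarrow> D \<subseteq> boolean_lattice n \<and> (\<forall>X Y. X \<in> D \<longrightarrow> Y \<subseteq> X \<longrightarrow> Y \<in> D)"

definition maximal_elements :: "nat set set \<Rightarrow> nat set set" where
  "maximal_elements D = {X \<in> D. \<forall>Y\<in>D. X \<subseteq> Y \<longrightarrow> Y = X}"

definition num_maximal :: "nat set set \<Rightarrow> nat" where
  "num_maximal D = card (maximal_elements D)"

text \<open>The conjunct \<open>A \<noteq> B\<close> guards against \<open>Max {}\<close>, which is unspecified.\<close>

definition level_colex_less :: "nat set \<Rightarrow> nat set \<Rightarrow> bool" where
  "level_colex_less A B \<longleftrightarrow>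
     card A < card B \<or> (card A = card B \<and> A \<noteq> B \<and> Max (sym_diff A B) \<in> B)"

text \<open>The first \<open>k\<close> elements are those with fewer than \<open>k\<close> predecessors. The lemmas
  \<open>card_level_colex_first\<close> and \<open>level_colex_first_less\<close> below confirm that for \<open>k \<le> 2 ^ n\<close>
  these are exactly \<open>k\<close> sets, each preceding every remaining set.\<close>

definition level_colex_first :: "nat \<Rightarrow> nat \<Rightarrow> nat set set" where
  "level_colex_first n k =
     {X \<in> boolean_lattice n. card {Y \<in> boolean_lattice n. level_colex_less Y X} < k}"

lemma finite_boolean_lattice: "finite (boolean_lattice n)"
  by (simp add: boolean_lattice_def)

lemma card_boolean_lattice: "card (boolean_lattice n) = 2 ^ n"
  by (simp add: boolean_lattice_def card_Pow)

lemma finite_in_boolean_lattice: "X \<in> boolean_lattice n \<Longrightarrow> finite X"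
  by (auto simp: boolean_lattice_def intro: finite_subset)

lemma Max_sym_diff_in_iff:
  fixes A B :: "nat set"
  assumes "finite A" "finite B"
  shows "(A \<noteq> B \<and> Max (sym_diff A B) \<in> B) \<longleftrightarrow>
         (\<exists>i. i \<in> B \<and> i \<notin> A \<and> (\<forall>j>i. j \<in> A \<longleftrightarrow> j \<in> B))"
proof
  assume L: "A \<noteq> B \<and> Max (sym_diff A B) \<in> B"
  let ?i = "Max (sym_diff A B)"
  have fin: "finite (sym_diff A B)" and "sym_diff A B \<noteq> {}"
    using assms L by auto
  then have "?i \<in> sym_diff A B" by (rule Max_in)
  then have "?i \<notin> A" using L by blast
  moreover have "j \<in> A \<longleftrightarrow> j \<in> B" if "j > ?i" for j
    using Max_ge[OF fin, of j] that by auto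
  ultimately show "\<exists>i. i \<in> B \<and> i \<notin> A \<and> (\<forall>j>i. j \<in> A \<longleftrightarrow> j \<in> B)"
    using L by blast
next
  assume "\<exists>i. i \<in> B \<and> i \<notin> A \<and> (\<forall>j>i. j \<in> A \<longleftrightarrow> j \<in> B)"
  then obtain i where i: "i \<in> B" "i \<notin> A" "\<And>j. j > i \<Longrightarrow> j \<in> A \<longleftrightarrow> j \<in> B"
    by blast
  have "Max (sym_diff A B) = i"
  proof (rule Max_eqI)
    show "finite (sym_diff A B)" using assms by simp
    show "y \<le> i" if "y \<in> sym_diff A B" for y
      using i(3)[of y] that by (meson DiffE UnE not_le)
    show "i \<in> sym_diff A B" using i by simp
  qed
  then show "A \<noteq> B \<and> Max (sym_diff A B) \<in> B" using i by auto
qed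

lemma level_colex_less_irrefl: "\<not> level_colex_less A A"
  by (simp add: level_colex_less_def)

lemma level_colex_less_total:
  assumes "finite A" "finite B" "A \<noteq> B"
  shows "level_colex_less A B \<or> level_colex_less B A"
proof -
  have "Max (sym_diff A B) \<in> sym_diff A B"
    using assms by (intro Max_in) auto
  then have "Max (sym_diff A B) \<in> A \<or> Max (sym_diff A B) \<in> B" by blast
  moreover have "sym_diff B A = sym_diff A B" by (rule Un_commute)
  ultimately show ?thesis
    using assms(3) by (cases "card A" "card B" rule: linorder_cases) (auto simp only: level_colex_less_def)
qed

lemma level_colex_less_trans:
  assumes fin: "finite A" "finite B" "finite C"
    and AB: "level_colex_less A B" and BC: "level_colex_less B C"
  shows "level_colex_less A C"
proof (cases "card A = card B \<and> card B = card C")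
  case False
  then show ?thesis using AB BC by (auto simp: level_colex_less_def)
next
  case True
  obtain i where i: "i \<in> B" "i \<notin> A" "\<forall>j>i. j \<in> A \<longleftrightarrow> j \<in> B"
    using AB True Max_sym_diff_in_iff[OF fin(1,2)] by (auto simp: level_colex_less_def)
  obtain k where k: "k \<in> C" "k \<notin> B" "\<forall>j>k. j \<in> B \<longleftrightarrow> j \<in> C"
    using BC True Max_sym_diff_in_iff[OF fin(2,3)] by (auto simp: level_colex_less_def)
  have "max i k \<in> C \<and> max i k \<notin> A \<and> (\<forall>j>max i k. j \<in> A \<longleftrightarrow> j \<in> C)"
    using i k by (cases i k rule: linorder_cases) (auto simp: max_def)
  then show ?thesis
    using True Max_sym_diff_in_iff[OF fin(1,3)] by (auto simp: level_colex_less_def)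
qed

lemma level_colex_rank_mono:
  assumes X: "X \<in> boolean_lattice n" and Y: "Y \<in> boolean_lattice n" and "level_colex_less X Y"
  shows "card {Z \<in> boolean_lattice n. level_colex_less Z X}
       < card {Z \<in> boolean_lattice n. level_colex_less Z Y}"
proof (rule psubset_card_mono)
  show "finite {Z \<in> boolean_lattice n. level_colex_less Z Y}"
    by (simp add: finite_boolean_lattice)
  show "{Z \<in> boolean_lattice n. level_colex_less Z X}
      \<subset> {Z \<in> boolean_lattice n. level_colex_less Z Y}"
  proof
    show "{Z \<in> boolean_lattice n. level_colex_less Z X}
        \<subseteq> {Z \<in> boolean_lattice n. level_colex_less Z Y}"
      using level_colex_less_trans[OF _ _ _ _ assms(3)] X Y finite_in_boolean_lattice by auto
    show "{Z \<in> boolean_lattice n. level_colex_less Z X}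
        \<noteq> {Z \<in> boolean_lattice n. level_colex_less Z Y}"
      using X assms(3) level_colex_less_irrefl[of X] by auto
  qed
qed

lemma level_colex_first_less:
  assumes X: "X \<in> level_colex_first n k" and Y: "Y \<in> boolean_lattice n - level_colex_first n k"
  shows "level_colex_less X Y"
proof (rule ccontr)
  assume "\<not> level_colex_less X Y"
  moreover have XY: "X \<in> boolean_lattice n" "Y \<in> boolean_lattice n" "X \<noteq> Y"
    using X Y by (auto simp: level_colex_first_def)
  ultimately have "level_colex_less Y X"
    using level_colex_less_total[of X Y] finite_in_boolean_lattice[of _ n] by simp
  then show False
    using level_colex_rank_mono[of Y n X] X Y XY by (auto simp: level_colex_first_def)
qed

lemma card_level_colex_first:
  assumes "k \<le> 2 ^ n"
  shows "card (level_colex_first n k) = k"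
proof -
  let ?B = "boolean_lattice n"
  define r where "r X = card {Y \<in> ?B. level_colex_less Y X}" for X
  have inj: "inj_on r ?B"
  proof (rule inj_onI, rule ccontr)
    fix X Y assume XY: "X \<in> ?B" "Y \<in> ?B" "r X = r Y" "X \<noteq> Y"
    then have "level_colex_less X Y \<or> level_colex_less Y X"
      using level_colex_less_total[of X Y] finite_in_boolean_lattice[of _ n] by simp
    then show False
      using level_colex_rank_mono[of X n Y] level_colex_rank_mono[of Y n X] XY
      by (auto simp: r_def)
  qed
  have "r X < card ?B" if "X \<in> ?B" for X
    unfolding r_def
  proof (rule psubset_card_mono[OF finite_boolean_lattice])
    show "{Y \<in> ?B. level_colex_less Y X} \<subset> ?B"
      using that level_colex_less_irrefl[of X] by blast
  qed
  then have "r ` ?B \<subseteq> {..<2 ^ n}"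
    by (auto simp: card_boolean_lattice)
  moreover have "card (r ` ?B) = 2 ^ n"
    by (simp add: card_image[OF inj] card_boolean_lattice)
  ultimately have img: "r ` ?B = {..<2 ^ n}"
    by (intro card_subset_eq) auto
  have first: "level_colex_first n k = {X \<in> ?B. r X < k}"
    by (simp add: level_colex_first_def r_def)
  have "r ` level_colex_first n k = {..<k}"
  proof
    show "{..<k} \<subseteq> r ` level_colex_first n k"
    proof
      fix i assume "i \<in> {..<k}"
      then have "i < k" "i \<in> r ` ?B" using assms img by auto
      then show "i \<in> r ` level_colex_first n k" by (auto simp: first)
    qed
  qed (auto simp: first)
  moreover have "inj_on r (level_colex_first n k)"
    by (rule inj_on_subset[OF inj]) (auto simp: first)
  ultimately show ?thesis
    by (metis card_image card_lessThan)
qed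

end

theory Submission
  imports Defs
begin

text \<open>The non-maximal elements of a downset \<open>F\<close> are exactly the elements of its shadow, so the
  claim is that initial segments of level-colex minimise the shadow among downsets of a given
  size. Split \<open>F\<close> at a point \<open>i\<close> into the sets avoiding \<open>i\<close> and the link of \<open>i\<close>, two nested
  downsets on one point less, and replace both by initial segments. By induction, and because
  shadows of initial segments are again initial segments, hence nested, this does not enlarge
  the shadow. A compression that changes \<open>F\<close> decreases the sum of the level-colex ranks, so
  eventually \<open>F\<close> is stable under compression at every \<open>i\<close>. Then \<open>Y < X\<close> with \<open>X \<in> F\<close> and
  \<open>Y \<notin> F\<close> forces \<open>X\<close> and \<open>Y\<close> to be complementary. There is at most one such pair, and exchanging
  \<open>X\<close> for \<open>Y\<close> yields an initial segment whose shadow is contained in that of \<open>F\<close>.\<close>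


section \<open>Initial segments of finite linear orders\<close>

definition rank_on :: "('a \<Rightarrow> 'a \<Rightarrow> bool) \<Rightarrow> 'a set \<Rightarrow> 'a \<Rightarrow> nat" where
  "rank_on R A x = card {y \<in> A. R y x}"

definition first_elements :: "('a \<Rightarrow> 'a \<Rightarrow> bool) \<Rightarrow> 'a set \<Rightarrow> nat \<Rightarrow> 'a set" where
  "first_elements R A k = {x \<in> A. rank_on R A x < k}"

definition initial_segment :: "('a \<Rightarrow> 'a \<Rightarrow> bool) \<Rightarrow> 'a set \<Rightarrow> 'a set \<Rightarrow> bool" where
  "initial_segment R A F \<longleftrightarrow> F \<subseteq> A \<and> (\<forall>x\<in>F. \<forall>y\<in>A. R y x \<longrightarrow> y \<in> F)"

definition inversions :: "('a \<Rightarrow> 'a \<Rightarrow> bool) \<Rightarrow> 'a set \<Rightarrow> 'a set \<Rightarrow> ('a \<times> 'a) set" where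
  "inversions R A F = {(x, y). x \<in> F \<and> y \<in> A - F \<and> R y x}"

lemma first_elements_subset: "first_elements R A k \<subseteq> A"
  by (auto simp: first_elements_def)

lemma first_elements_mono: "k \<le> l \<Longrightarrow> first_elements R A k \<subseteq> first_elements R A l"
  by (auto simp: first_elements_def)

lemma initial_segment_iff_no_inversions:
  "initial_segment R A F \<longleftrightarrow> F \<subseteq> A \<and> inversions R A F = {}"
  by (auto simp: initial_segment_def inversions_def)

lemma mem_inversions_iff: "(x, y) \<in> inversions R A F \<longleftrightarrow> x \<in> F \<and> y \<in> A \<and> y \<notin> F \<and> R y x"
  by (auto simp: inversions_def)

lemma inversions_eq_singletonD:
  assumes "inversions R A F = {(x, y)}"
  shows "x \<in> F" "y \<in> A" "y \<notin> F" "R y x"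
  using assms mem_inversions_iff[of x y R A F] by simp_all

locale finite_strict_linorder =
  fixes R :: "'a \<Rightarrow> 'a \<Rightarrow> bool" (infix "\<prec>" 50) and A :: "'a set"
  assumes finite_carrier: "finite A"
    and irrefl: "irreflp_on A (\<prec>)"
    and trans: "transp_on A (\<prec>)"
    and total: "totalp_on A (\<prec>)"
begin

lemma monotone_on_rank: "monotone_on A (\<prec>) (<) (rank_on (\<prec>) A)"
proof (rule monotone_onI)
  fix x y assume xy: "x \<in> A" "y \<in> A" "x \<prec> y"
  have "{z \<in> A. z \<prec> x} \<subset> {z \<in> A. z \<prec> y}"
    using xy irreflp_onD[OF irrefl] transp_onD[OF trans] by blast
  then show "rank_on (\<prec>) A x < rank_on (\<prec>) A y"
    unfolding rank_on_def using finite_carrier by (intro psubset_card_mono) auto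
qed

lemma inj_on_rank: "inj_on (rank_on (\<prec>) A) A"
proof (rule inj_onI, rule ccontr)
  fix x y assume "x \<in> A" "y \<in> A" "rank_on (\<prec>) A x = rank_on (\<prec>) A y" "x \<noteq> y"
  then show False
    using totalp_onD[OF total, of x y] monotone_onD[OF monotone_on_rank] by fastforce
qed

lemma rank_image: "rank_on (\<prec>) A ` A = {..<card A}"
proof (rule card_subset_eq)
  have "rank_on (\<prec>) A x < card A" if "x \<in> A" for x
    unfolding rank_on_def using that irreflp_onD[OF irrefl that]
    by (intro psubset_card_mono[OF finite_carrier]) blast
  then show "rank_on (\<prec>) A ` A \<subseteq> {..<card A}" by auto
qed (simp_all add: card_image inj_on_rank)

lemma card_first_elements:
  assumes "k \<le> card A"
  shows "card (first_elements (\<prec>) A k) = k"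
proof -
  have "rank_on (\<prec>) A ` first_elements (\<prec>) A k = rank_on (\<prec>) A ` A \<inter> {..<k}"
    by (auto simp: first_elements_def)
  also have "\<dots> = {..<k}"
    using assms by (auto simp: rank_image)
  finally show ?thesis
    using card_image[OF inj_on_subset[OF inj_on_rank first_elements_subset]]
    by (metis card_lessThan)
qed

lemma initial_segment_first_elements: "initial_segment (\<prec>) A (first_elements (\<prec>) A k)"
  unfolding initial_segment_def first_elements_def
  using monotone_onD[OF monotone_on_rank] by fastforce

lemma initial_segment_eq_first_elements:
  assumes "initial_segment (\<prec>) A F"
  shows "F = first_elements (\<prec>) A (card F)"
proof (rule card_subset_eq)
  have F: "F \<subseteq> A" using assms by (simp add: initial_segment_def)
  have fin: "finite F" using F finite_carrier by (rule finite_subset)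
  show "finite (first_elements (\<prec>) A (card F))"
    using finite_subset[OF first_elements_subset finite_carrier] .
  have "rank_on (\<prec>) A x < card F" if "x \<in> F" for x
  proof -
    have "{y \<in> A. y \<prec> x} \<subset> F"
      using that F assms irreflp_onD[OF irrefl, of x] by (auto simp: initial_segment_def)
    then show ?thesis unfolding rank_on_def by (rule psubset_card_mono[OF fin])
  qed
  then show "F \<subseteq> first_elements (\<prec>) A (card F)"
    using F by (auto simp: first_elements_def)
  show "card F = card (first_elements (\<prec>) A (card F))"
    using card_first_elements card_mono[OF finite_carrier F] by simp
qed

lemma initial_segments_nested:
  assumes "initial_segment (\<prec>) A F" "initial_segment (\<prec>) A G"
  shows "F \<subseteq> G \<or> G \<subseteq> F"
proof -
  have "first_elements (\<prec>) A (card F) \<subseteq> first_elements (\<prec>) A (card G) \<or>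
      first_elements (\<prec>) A (card G) \<subseteq> first_elements (\<prec>) A (card F)"
    using linear[of "card F" "card G"] by (elim disjE) (simp_all add: first_elements_mono)
  then show ?thesis
    using assms[THEN initial_segment_eq_first_elements, symmetric] by simp
qed

lemma sum_first_elements_less:
  fixes g :: "'a \<Rightarrow> 'b::ordered_cancel_comm_monoid_add"
  assumes F: "F \<subseteq> A" "F \<noteq> first_elements (\<prec>) A (card F)"
    and mono: "monotone_on A (\<prec>) (<) g"
  shows "sum g (first_elements (\<prec>) A (card F)) < sum g F"
proof -
  define G where "G = first_elements (\<prec>) A (card F)"
  have G: "initial_segment (\<prec>) A G" "G \<subseteq> A"
    by (simp_all add: G_def initial_segment_first_elements first_elements_subset)
  have fin: "finite F" "finite G"
    using F(1) G(2) finite_carrier by (auto intro: finite_subset)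
  have card: "card G = card F"
    using card_first_elements card_mono[OF finite_carrier F(1)] by (simp add: G_def)
  then have "card (F - G) = card (G - F)"
    using fin by (simp add: card_Diff_subset_Int Int_commute)
  then obtain h where h: "bij_betw h (F - G) (G - F)"
    using fin by (meson finite_Diff finite_same_card_bij)
  have "F - G \<noteq> {}"
    using F(2) fin card by (metis G_def Diff_eq_empty_iff card_subset_eq)
  have less: "g (h x) < g x" if x: "x \<in> F - G" for x
  proof (rule monotone_onD[OF mono])
    have hx: "h x \<in> G - F" using h x by (auto dest: bij_betwE)
    then show "h x \<in> A" "x \<in> A" using x F(1) G(2) by auto
    moreover have "h x \<noteq> x" using hx x by auto
    ultimately have "h x \<prec> x \<or> x \<prec> h x" using totalp_onD[OF total] by blast
    then show "h x \<prec> x"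
      using hx x \<open>x \<in> A\<close> G(1) unfolding initial_segment_def by blast
  qed
  have "sum g (G - F) = (\<Sum>x\<in>F - G. g (h x))"
    using sum.reindex_bij_betw[OF h, of g] by simp
  also have "\<dots> < sum g (F - G)"
    using fin \<open>F - G \<noteq> {}\<close> less by (intro sum_strict_mono) auto
  finally have "sum g (F \<inter> G) + sum g (G - F) < sum g (F \<inter> G) + sum g (F - G)"
    by (rule add_strict_left_mono)
  then show ?thesis
    using sum.Int_Diff[OF fin(1), of g G] sum.Int_Diff[OF fin(2), of g F]
    by (simp add: G_def Int_commute)
qed

lemma sum_first_elements_le:
  fixes g :: "'a \<Rightarrow> 'b::ordered_cancel_comm_monoid_add"
  assumes "F \<subseteq> A" "monotone_on A (\<prec>) (<) g"
  shows "sum g (first_elements (\<prec>) A (card F)) \<le> sum g F"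
  using sum_first_elements_less[OF assms(1) _ assms(2)]
  by (metis order.strict_implies_order order_refl)

lemma initial_segment_exchange_inversion:
  assumes F: "F \<subseteq> A" and inv: "inversions (\<prec>) A F = {(x, y)}"
  shows "initial_segment (\<prec>) A (insert y (F - {x}))"
proof -
  note xy = inversions_eq_singletonD[OF inv]
  have unique: "w = x \<and> z = y" if "w \<in> F" "z \<in> A" "z \<notin> F" "z \<prec> w" for w z
  proof -
    have "(w, z) \<in> inversions (\<prec>) A F" using that by (simp add: mem_inversions_iff)
    then show ?thesis using inv by simp
  qed
  have "z \<in> insert y (F - {x})" if "w \<in> insert y (F - {x})" "z \<in> A" "z \<prec> w" for w z
  proof (cases "w = y")
    case True
    then have "z \<prec> x"
      using that xy F transp_onD[OF trans, of z y x] by blast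
    moreover have "x \<noteq> z"
      using calculation that(2) irreflp_onD[OF irrefl] by blast
    ultimately show ?thesis using unique[of x z] xy(1) that(2) by blast
  next
    case False
    then have w: "w \<in> F" "w \<noteq> x" using that(1) by auto
    have "z \<noteq> x"
      using unique[of w y] w xy that transp_onD[OF trans, of y x w] F by blast
    then show ?thesis using unique[of w z] w that by blast
  qed
  then show ?thesis using F xy by (auto simp: initial_segment_def)
qed

end


section \<open>The level-colex order\<close>

abbreviation level_colex_initial :: "nat set \<Rightarrow> nat set set \<Rightarrow> bool" where
  "level_colex_initial S \<equiv> initial_segment level_colex_less (Pow S)"

abbreviation level_colex_segment :: "nat set \<Rightarrow> nat \<Rightarrow> nat set set" where
  "level_colex_segment S \<equiv> first_elements level_colex_less (Pow S)"

abbreviation level_colex_rank :: "nat set \<Rightarrow> nat set \<Rightarrow> nat" where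
  "level_colex_rank S \<equiv> rank_on level_colex_less (Pow S)"

abbreviation level_colex_inversions :: "nat set \<Rightarrow> nat set set \<Rightarrow> (nat set \<times> nat set) set" where
  "level_colex_inversions S \<equiv> inversions level_colex_less (Pow S)"

lemma level_colex_strict_linorder:
  assumes "finite S"
  shows "finite_strict_linorder level_colex_less (Pow S)"
proof
  have fin: "finite X" if "X \<in> Pow S" for X
    using that assms by (auto intro: finite_subset)
  show "finite (Pow S)" using assms by simp
  show "irreflp_on (Pow S) level_colex_less"
    by (simp add: irreflp_on_def level_colex_less_irrefl)
  show "transp_on (Pow S) level_colex_less"
    by (rule transp_onI) (metis fin level_colex_less_trans)
  show "totalp_on (Pow S) level_colex_less"
    by (rule totalp_onI) (metis fin level_colex_less_total)
qed

lemma level_colex_less_if_card: "card X < card Y \<Longrightarrow> level_colex_less X Y"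
  by (simp add: level_colex_less_def)

lemma level_colex_less_imp_card_le: "level_colex_less X Y \<Longrightarrow> card X \<le> card Y"
  by (auto simp: level_colex_less_def)

lemma level_colex_less_iff:
  assumes "finite X" "finite Y"
  shows "level_colex_less X Y \<longleftrightarrow> card X < card Y \<or>
    card X = card Y \<and> (\<exists>d. d \<in> Y \<and> d \<notin> X \<and> (\<forall>j>d. j \<in> X \<longleftrightarrow> j \<in> Y))"
  unfolding level_colex_less_def using Max_sym_diff_in_iff[OF assms] by simp

lemma level_colex_less_insert_iff:
  assumes "finite X" "finite Y" "i \<notin> X" "i \<notin> Y"
  shows "level_colex_less (insert i X) (insert i Y) \<longleftrightarrow> level_colex_less X Y"
proof -
  have "sym_diff (insert i X) (insert i Y) = sym_diff X Y"
    using assms by auto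
  moreover have "insert i X = insert i Y \<longleftrightarrow> X = Y"
    using assms by (simp add: insert_ident)
  moreover have "Max (sym_diff X Y) \<noteq> i" if "X \<noteq> Y"
    using Max_in[of "sym_diff X Y"] that assms by auto
  ultimately show ?thesis
    using assms by (auto simp: level_colex_less_def)
qed

lemma level_colex_less_exchange:
  assumes "finite U" "a \<notin> U" "b \<notin> U" "a < b"
  shows "level_colex_less (insert a U) (insert b U)"
  using assms by (subst level_colex_less_iff) (auto intro!: exI[of _ b])

lemma level_colex_less_complement_iff:
  assumes "finite S" "X \<subseteq> S" "S \<noteq> {}"
  shows "level_colex_less (S - X) X \<longleftrightarrow>
    card (S - X) < card X \<or> card (S - X) = card X \<and> Max S \<in> X"
proof -
  have "sym_diff (S - X) X = S" "S - X \<noteq> X" using assms by auto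
  then show ?thesis by (simp add: level_colex_less_def)
qed

lemma not_level_colex_less_insert_Min:
  assumes S: "finite S" "Y \<subset> S" "insert j X \<subseteq> S" and j: "j \<notin> X"
    and less: "level_colex_less Y X"
  shows "\<not> level_colex_less (insert j X) (insert (Min (S - Y)) Y)"
proof
  define b where "b = Min (S - Y)"
  assume "level_colex_less (insert j X) (insert (Min (S - Y)) Y)"
  then have rev: "level_colex_less (insert j X) (insert b Y)" by (simp add: b_def)
  have "b \<in> S - Y" unfolding b_def using S by (intro Min_in) auto
  then have b: "b \<in> S" "b \<notin> Y" by auto
  have b_le: "b \<le> x" if "x \<in> S" "x \<notin> Y" for x
    unfolding b_def using S(1) that by (intro Min_le) auto
  have fin: "finite X" "finite Y" using S by (auto intro: finite_subset)
  have card: "card Y = card X"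
    using level_colex_less_imp_card_le[OF less] level_colex_less_imp_card_le[OF rev] fin b j by simp
  then obtain d where d: "d \<in> X" "d \<notin> Y" "\<And>x. x > d \<Longrightarrow> x \<in> Y \<longleftrightarrow> x \<in> X"
    using less fin by (auto simp: level_colex_less_iff)
  obtain e where e: "e \<in> insert b Y" "e \<notin> insert j X"
      "\<And>x. x > e \<Longrightarrow> x \<in> insert j X \<longleftrightarrow> x \<in> insert b Y"
    using rev fin b j card by (auto simp: level_colex_less_iff)
  have "e < b"
  proof (rule ccontr)
    assume "\<not> e < b"
    then have "\<not> e < d" using e(3)[of d] d(1,2) by auto
    moreover have "e \<noteq> d" using d(1) e(2) by blast
    ultimately have "e > d" by simp
    moreover have "b \<le> d" using b_le d S(3) by blast
    ultimately have "e \<in> Y" using e(1) by auto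
    then show False using d(3) e(2) \<open>e > d\<close> by blast
  qed
  have "insert j X \<subseteq> insert b Y"
  proof
    fix x assume "x \<in> insert j X"
    then show "x \<in> insert b Y"
      using e(3)[of x] b_le[of x] \<open>e < b\<close> S(3) by (cases "e < x") auto
  qed
  then have "insert j X = insert b Y"
    using fin b j card by (intro card_subset_eq) auto
  then show False using e by blast
qed


section \<open>Shadows and downsets\<close>

definition down_closed :: "'a set set \<Rightarrow> bool" where
  "down_closed F \<longleftrightarrow> (\<forall>X Y. X \<in> F \<longrightarrow> Y \<subseteq> X \<longrightarrow> Y \<in> F)"

definition shadow :: "'a set set \<Rightarrow> 'a set set" where
  "shadow F = {X. \<exists>j. j \<notin> X \<and> insert j X \<in> F}"

lemma down_closedD: "down_closed F \<Longrightarrow> X \<in> F \<Longrightarrow> Y \<subseteq> X \<Longrightarrow> Y \<in> F"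
  by (auto simp: down_closed_def)

lemma shadow_insert: "shadow (insert X F) = shadow {X} \<union> shadow F"
  by (auto simp: shadow_def)

lemma shadow_mono: "F \<subseteq> G \<Longrightarrow> shadow F \<subseteq> shadow G"
  by (auto simp: shadow_def)

lemma shadow_singleton: "shadow {{x}} = {{}}"
  by (auto simp: shadow_def insert_eq_iff)

lemma Union_shadow_subset: "\<Union>(shadow F) \<subseteq> \<Union>F"
  by (auto simp: shadow_def)

lemma finite_shadow:
  assumes "finite S" "F \<subseteq> Pow S"
  shows "finite (shadow F)"
  using assms Union_shadow_subset[of F] by (intro finite_subset[of "shadow F" "Pow S"]) auto

lemma maximal_elements_down_closed:
  assumes "down_closed F"
  shows "maximal_elements F = F - shadow F"
proof (intro equalityI subsetI)
  fix X assume "X \<in> maximal_elements F"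
  then show "X \<in> F - shadow F" by (auto simp: maximal_elements_def shadow_def)
next
  fix X assume X: "X \<in> F - shadow F"
  have "Y = X" if Y: "Y \<in> F" "X \<subseteq> Y" for Y
  proof (rule ccontr)
    assume "Y \<noteq> X"
    then obtain j where j: "j \<in> Y" "j \<notin> X" using Y by blast
    then have "insert j X \<in> F" using Y down_closedD[OF assms] by blast
    then show False using X j by (auto simp: shadow_def)
  qed
  then show "X \<in> maximal_elements F" using X by (auto simp: maximal_elements_def)
qed

lemma num_maximal_down_closed:
  assumes "finite F" "down_closed F"
  shows "num_maximal F = card F - card (shadow F)"
proof -
  have "shadow F \<subseteq> F" using down_closedD[OF assms(2)] by (auto simp: shadow_def)
  then show ?thesis
    using assms by (simp add: num_maximal_def maximal_elements_down_closed card_Diff_subset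
        finite_subset)
qed

lemma level_colex_initial_down_closed:
  assumes "finite S" "level_colex_initial S F"
  shows "down_closed F"
  unfolding down_closed_def
proof (intro allI impI)
  fix X Y assume XY: "X \<in> F" "Y \<subseteq> X"
  have "X \<subseteq> S" using assms(2) XY(1) by (auto simp: initial_segment_def)
  moreover have "finite X" using \<open>X \<subseteq> S\<close> assms(1) by (rule finite_subset)
  then have "Y = X \<or> level_colex_less Y X"
    using XY(2) by (metis level_colex_less_if_card psubsetI psubset_card_mono)
  ultimately show "Y \<in> F"
    using XY assms(2) unfolding initial_segment_def by blast
qed

lemma level_colex_initial_shadow:
  assumes S: "finite S" and F: "level_colex_initial S F"
  shows "level_colex_initial S (shadow F)"
  unfolding initial_segment_def
proof (intro conjI ballI impI)
  interpret finite_strict_linorder level_colex_less "Pow S"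
    using S by (rule level_colex_strict_linorder)
  show "shadow F \<subseteq> Pow S"
    using F Union_shadow_subset[of F] by (auto simp: initial_segment_def)
  fix X Y assume "X \<in> shadow F" and Y: "Y \<in> Pow S" and less: "level_colex_less Y X"
  then obtain j where j: "j \<notin> X" "insert j X \<in> F" by (auto simp: shadow_def)
  then have jX: "insert j X \<subseteq> S" using F by (auto simp: initial_segment_def)
  have "card Y < card (insert j X)"
    using level_colex_less_imp_card_le[OF less] j(1) jX finite_subset[OF _ S] by simp
  then have YS: "Y \<subset> S" using Y card_mono[OF S jX] by auto
  define b where "b = Min (S - Y)"
  have "b \<in> S - Y" unfolding b_def using S YS by (intro Min_in) auto
  moreover have "\<not> level_colex_less (insert j X) (insert b Y)"
    unfolding b_def using not_level_colex_less_insert_Min[OF S YS jX j(1) less] .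
  ultimately have "insert b Y = insert j X \<or> level_colex_less (insert b Y) (insert j X)"
    using totalp_onD[OF total, of "insert b Y" "insert j X"] Y jX by auto
  then have "insert b Y \<in> F"
    using F j(2) Y \<open>b \<in> S - Y\<close> unfolding initial_segment_def by auto
  then show "Y \<in> shadow F" using \<open>b \<in> S - Y\<close> by (auto simp: shadow_def)
qed


section \<open>Compression at a point\<close>

definition deletion :: "'a \<Rightarrow> 'a set set \<Rightarrow> 'a set set" where
  "deletion i F = {X \<in> F. i \<notin> X}"

definition link :: "'a \<Rightarrow> 'a set set \<Rightarrow> 'a set set" where
  "link i F = {X. i \<notin> X \<and> insert i X \<in> F}"

definition join_at :: "'a \<Rightarrow> 'a set set \<Rightarrow> 'a set set \<Rightarrow> 'a set set" where
  "join_at i F0 F1 = F0 \<union> insert i ` F1"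

definition compression :: "nat set \<Rightarrow> nat \<Rightarrow> nat set set \<Rightarrow> nat set set" where
  "compression S i F = join_at i (level_colex_segment (S - {i}) (card (deletion i F)))
     (level_colex_segment (S - {i}) (card (link i F)))"

lemma deletion_subset_Pow: "F \<subseteq> Pow S \<Longrightarrow> deletion i F \<subseteq> Pow (S - {i})"
  by (auto simp: deletion_def)

lemma link_subset_Pow: "F \<subseteq> Pow S \<Longrightarrow> link i F \<subseteq> Pow (S - {i})"
  by (auto simp: link_def)

lemma down_closed_deletion: "down_closed F \<Longrightarrow> down_closed (deletion i F)"
  by (auto simp: down_closed_def deletion_def)

lemma down_closed_link: "down_closed F \<Longrightarrow> down_closed (link i F)"
  unfolding down_closed_def link_def by (blast dest: insert_mono)

lemma link_subset_deletion: "down_closed F \<Longrightarrow> link i F \<subseteq> deletion i F"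
  by (auto simp: link_def deletion_def dest: down_closedD)

lemma notin_Union_deletion: "i \<notin> \<Union>(deletion i F)"
  by (simp add: deletion_def)

lemma notin_Union_link: "i \<notin> \<Union>(link i F)"
  by (simp add: link_def)

lemma notin_Union_level_colex_segment: "i \<notin> \<Union>(level_colex_segment (S - {i}) k)"
  using first_elements_subset[of level_colex_less "Pow (S - {i})" k] by blast

lemma mem_join_at_iff:
  assumes "i \<notin> \<Union>F0" "i \<notin> \<Union>F1"
  shows "X \<in> join_at i F0 F1 \<longleftrightarrow> (if i \<in> X then X - {i} \<in> F1 else X \<in> F0)"
proof -
  have "X \<in> insert i ` F1 \<longleftrightarrow> i \<in> X \<and> X - {i} \<in> F1"
  proof
    assume "X \<in> insert i ` F1"
    then show "i \<in> X \<and> X - {i} \<in> F1" using assms(2) by (auto simp: insert_Diff_if)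
  next
    assume "i \<in> X \<and> X - {i} \<in> F1"
    then show "X \<in> insert i ` F1" by (metis imageI insert_Diff)
  qed
  then show ?thesis using assms(1) by (auto simp: join_at_def)
qed

lemma join_at_deletion_link: "join_at i (deletion i F) (link i F) = F"
  unfolding set_eq_iff mem_join_at_iff[OF notin_Union_deletion notin_Union_link]
  by (auto simp: deletion_def link_def insert_absorb)

lemma deletion_join_at: "i \<notin> \<Union>F0 \<Longrightarrow> deletion i (join_at i F0 F1) = F0"
  by (auto simp: join_at_def deletion_def)

lemma link_join_at: "i \<notin> \<Union>F0 \<Longrightarrow> i \<notin> \<Union>F1 \<Longrightarrow> link i (join_at i F0 F1) = F1"
  by (auto simp: mem_join_at_iff link_def)

lemma down_closed_join_at:
  assumes "i \<notin> \<Union>F0" "i \<notin> \<Union>F1" "down_closed F0" "down_closed F1" "F1 \<subseteq> F0"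
  shows "down_closed (join_at i F0 F1)"
  unfolding down_closed_def
proof (intro allI impI)
  fix X Y assume X: "X \<in> join_at i F0 F1" and Y: "Y \<subseteq> X"
  have "Y - {i} \<subseteq> X - {i}" using Y by blast
  then show "Y \<in> join_at i F0 F1"
    using X Y assms(5) down_closedD[OF assms(3), of X Y] down_closedD[OF assms(4), of "X - {i}"]
    by (auto simp: mem_join_at_iff[OF assms(1,2)] split: if_splits)
qed

lemma deletion_shadow: "deletion i (shadow F) = link i F \<union> shadow (deletion i F)"
  by (auto simp: deletion_def link_def shadow_def)

lemma link_shadow: "link i (shadow F) = shadow (link i F)"
  by (auto simp: link_def shadow_def insert_commute)

lemma sum_deletion_link:
  fixes g :: "'a set \<Rightarrow> 'b::comm_monoid_add"
  assumes "finite F"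
  shows "sum g F = sum g (deletion i F) + (\<Sum>X\<in>link i F. g (insert i X))"
proof -
  have F: "F = deletion i F \<union> insert i ` link i F"
    using join_at_deletion_link[of i F] by (simp add: join_at_def)
  have "sum g F = sum g (deletion i F) + sum g (insert i ` link i F)"
    by (subst F, intro sum.union_disjoint)
      (use assms in \<open>auto simp: deletion_def link_def intro: finite_subset[of _ F]\<close>)
  moreover have "inj_on (insert i) (link i F)"
    by (auto simp: inj_on_def link_def insert_ident)
  ultimately show ?thesis by (simp add: sum.reindex)
qed

lemma card_deletion_link: "finite F \<Longrightarrow> card F = card (deletion i F) + card (link i F)"
  using sum_deletion_link[of F "\<lambda>_. 1 :: nat" i] by simp

lemma card_shadow_deletion_link:
  assumes "finite (shadow F)"
  shows "card (shadow F) = card (link i F \<union> shadow (deletion i F)) + card (shadow (link i F))"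
  using card_deletion_link[OF assms, of i] by (simp add: deletion_shadow link_shadow)

lemma deletion_compression:
  "deletion i (compression S i F) = level_colex_segment (S - {i}) (card (deletion i F))"
  unfolding compression_def by (rule deletion_join_at[OF notin_Union_level_colex_segment])

lemma link_compression:
  "link i (compression S i F) = level_colex_segment (S - {i}) (card (link i F))"
  unfolding compression_def
  by (rule link_join_at[OF notin_Union_level_colex_segment notin_Union_level_colex_segment])

lemma compression_subset_Pow:
  assumes "i \<in> S"
  shows "compression S i F \<subseteq> Pow S"
  using assms first_elements_subset[of level_colex_less "Pow (S - {i})"]
  unfolding compression_def join_at_def by fast

lemma card_level_colex_segment:
  assumes "finite S" "F \<subseteq> Pow S"
  shows "card (level_colex_segment S (card F)) = card F"
  using assms card_mono[of "Pow S" F]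
  by (intro finite_strict_linorder.card_first_elements level_colex_strict_linorder) auto

lemma level_colex_initial_segment:
  assumes "finite S"
  shows "level_colex_initial S (level_colex_segment S k)"
  using assms
  by (intro finite_strict_linorder.initial_segment_first_elements level_colex_strict_linorder)

context
  fixes S :: "nat set" and F :: "nat set set" and i :: nat
  assumes finite_S: "finite S" and i_in_S: "i \<in> S" and F_subset: "F \<subseteq> Pow S"
begin

interpretation S: finite_strict_linorder level_colex_less "Pow S"
  using finite_S by (rule level_colex_strict_linorder)

interpretation punctured: finite_strict_linorder level_colex_less "Pow (S - {i})"
  using finite_S by (intro level_colex_strict_linorder) simp

lemma finite_compression: "finite (compression S i F)"
  using compression_subset_Pow[OF i_in_S] S.finite_carrier by (rule finite_subset)

lemma card_compression: "card (compression S i F) = card F"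
  using card_deletion_link[OF finite_compression, of i]
    card_deletion_link[OF finite_subset[OF F_subset S.finite_carrier], of i]
    card_level_colex_segment[OF _ deletion_subset_Pow[OF F_subset, of i]]
    card_level_colex_segment[OF _ link_subset_Pow[OF F_subset, of i]] finite_S
  by (simp add: deletion_compression link_compression)

lemma down_closed_compression:
  assumes "down_closed F"
  shows "down_closed (compression S i F)"
  unfolding compression_def
proof (intro down_closed_join_at notin_Union_level_colex_segment first_elements_mono card_mono)
  show "finite (deletion i F)"
    using finite_subset[OF deletion_subset_Pow[OF F_subset] punctured.finite_carrier] .
  show "link i F \<subseteq> deletion i F" using assms by (rule link_subset_deletion)
qed (use finite_S in \<open>auto intro: level_colex_initial_down_closed level_colex_initial_segment\<close>)

lemma card_shadow_compression_le:
  assumes "card (shadow (deletion i (compression S i F))) \<le> card (shadow (deletion i F))"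
    and "card (shadow (link i (compression S i F))) \<le> card (shadow (link i F))"
  shows "card (shadow (compression S i F)) \<le> card (shadow F)"
proof -
  define D L where "D = deletion i (compression S i F)" and "L = link i (compression S i F)"
  have "level_colex_initial (S - {i}) L" "level_colex_initial (S - {i}) (shadow D)"
    using finite_S level_colex_initial_segment level_colex_initial_shadow
    by (simp_all add: D_def L_def deletion_compression link_compression)
  then have "L \<union> shadow D = L \<or> L \<union> shadow D = shadow D"
    using punctured.initial_segments_nested by blast
  moreover have "finite (link i F \<union> shadow (deletion i F))"
    using finite_subset[OF link_subset_Pow[OF F_subset] punctured.finite_carrier]
      finite_shadow[OF _ deletion_subset_Pow[OF F_subset]] finite_S by simp
  then have "card (link i F) \<le> card (link i F \<union> shadow (deletion i F))"
    "card (shadow (deletion i F)) \<le> card (link i F \<union> shadow (deletion i F))"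
    by (auto intro: card_mono)
  moreover have "card L = card (link i F)"
    using card_level_colex_segment[OF _ link_subset_Pow[OF F_subset, of i]] finite_S
    by (simp add: L_def link_compression)
  ultimately have "card (L \<union> shadow D) \<le> card (link i F \<union> shadow (deletion i F))"
    using assms(1) by (auto simp: D_def)
  moreover have "card (shadow (compression S i F)) = card (L \<union> shadow D) + card (shadow L)"
    unfolding D_def L_def using finite_S compression_subset_Pow[OF i_in_S]
    by (intro card_shadow_deletion_link finite_shadow)
  moreover have "card (shadow F)
      = card (link i F \<union> shadow (deletion i F)) + card (shadow (link i F))"
    using finite_S F_subset by (intro card_shadow_deletion_link finite_shadow)
  ultimately show ?thesis
    using assms(2) by (simp add: L_def)
qed

lemma sum_rank_compression_less:
  assumes "compression S i F \<noteq> F"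
  shows "sum (level_colex_rank S) (compression S i F) < sum (level_colex_rank S) F"
proof -
  let ?r = "level_colex_rank S" and ?r_insert = "\<lambda>X. level_colex_rank S (insert i X)"
  have mono_rank: "monotone_on (Pow (S - {i})) level_colex_less (<) ?r"
    using S.monotone_on_rank by (rule monotone_on_subset) blast
  have mono_rank_insert: "monotone_on (Pow (S - {i})) level_colex_less (<) ?r_insert"
  proof (rule monotone_onI)
    fix X Y assume XY: "X \<in> Pow (S - {i})" "Y \<in> Pow (S - {i})" "level_colex_less X Y"
    then have "finite X" "finite Y" "i \<notin> X" "i \<notin> Y"
      using finite_S by (auto intro: finite_subset)
    then have "level_colex_less (insert i X) (insert i Y)"
      using XY(3) by (simp add: level_colex_less_insert_iff)
    moreover have "insert i X \<in> Pow S" "insert i Y \<in> Pow S"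
      using XY(1,2) i_in_S by auto
    ultimately show "?r_insert X < ?r_insert Y"
      using monotone_onD[OF S.monotone_on_rank] by blast
  qed
  note sub = deletion_subset_Pow[OF F_subset, of i] link_subset_Pow[OF F_subset, of i]
  have "deletion i (compression S i F) \<noteq> deletion i F \<or> link i (compression S i F) \<noteq> link i F"
    using assms by (metis join_at_deletion_link)
  then have "sum ?r (deletion i (compression S i F)) + sum ?r_insert (link i (compression S i F))
      < sum ?r (deletion i F) + sum ?r_insert (link i F)"
    using punctured.sum_first_elements_le[OF sub(1) mono_rank]
      punctured.sum_first_elements_less[OF sub(1) _ mono_rank]
      punctured.sum_first_elements_le[OF sub(2) mono_rank_insert]
      punctured.sum_first_elements_less[OF sub(2) _ mono_rank_insert]
    unfolding deletion_compression link_compression by (metis add_less_le_mono add_le_less_mono)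
  then show ?thesis
    using sum_deletion_link[OF finite_compression, of ?r i]
      sum_deletion_link[OF finite_subset[OF F_subset S.finite_carrier], of ?r i] by simp
qed

end


section \<open>Compressed families\<close>

lemma compressed_inversion_complementary:
  assumes S: "finite S" and F: "F \<subseteq> Pow S"
    and compressed: "\<And>i. i \<in> S \<Longrightarrow> compression S i F = F"
    and inv: "(X, Y) \<in> level_colex_inversions S F"
  shows "Y = S - X"
proof -
  have XY: "X \<in> F" "X \<subseteq> S" "Y \<subseteq> S" "Y \<notin> F" "level_colex_less Y X"
    using inv F by (auto simp: mem_inversions_iff)
  have "(i \<in> X) \<noteq> (i \<in> Y)" if i: "i \<in> S" for i
  proof
    have initial: "level_colex_initial (S - {i}) (deletion i F)"
      "level_colex_initial (S - {i}) (link i F)"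
      using deletion_compression[of i S F] link_compression[of i S F] compressed[OF i]
        level_colex_initial_segment[of "S - {i}"] S by (metis finite_Diff)+
    assume eq: "(i \<in> X) = (i \<in> Y)"
    show False
    proof (cases "i \<in> X")
      case True
      then have ins: "insert i (X - {i}) = X" "insert i (Y - {i}) = Y" using eq by auto
      have "level_colex_less (Y - {i}) (X - {i})"
        using level_colex_less_insert_iff[of "Y - {i}" "X - {i}" i] ins XY finite_subset[OF _ S]
        by simp
      moreover have "X - {i} \<in> link i F" using ins XY(1) by (simp add: link_def)
      ultimately have "Y - {i} \<in> link i F"
        using initial(2) XY(3) unfolding initial_segment_def by blast
      then show False using ins XY(4) by (simp add: link_def)
    next
      case False
      then have "X \<in> deletion i F" "Y \<in> Pow (S - {i})" using eq XY by (auto simp: deletion_def)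
      then have "Y \<in> deletion i F" using initial(1) XY(5) unfolding initial_segment_def by blast
      then show False using XY(4) by (simp add: deletion_def)
    qed
  qed
  then show ?thesis using XY by blast
qed

lemma complementary_inversion_unique:
  assumes S: "finite S" and F: "F \<subseteq> Pow S"
    and compl: "\<And>X Y. (X, Y) \<in> level_colex_inversions S F \<Longrightarrow> Y = S - X"
    and inv: "(X, Y) \<in> level_colex_inversions S F" "(X', Y') \<in> level_colex_inversions S F"
  shows "X = X'"
proof (rule ccontr)
  interpret finite_strict_linorder level_colex_less "Pow S"
    using S by (rule level_colex_strict_linorder)
  have not_less: "\<not> level_colex_less U U'"
    if U: "(U, V) \<in> level_colex_inversions S F" "U' \<in> F" for U V U'
  proof
    assume less: "level_colex_less U U'"
    have sub: "U \<in> Pow S" "U' \<in> Pow S" using U F by (auto simp: mem_inversions_iff)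
    then have "(U', V) \<in> level_colex_inversions S F"
      using U less transp_onD[OF trans, of V U U'] by (auto simp: mem_inversions_iff)
    then have "U = U'" using compl U(1) sub by blast
    then show False using less level_colex_less_irrefl by blast
  qed
  assume "X \<noteq> X'"
  then have "level_colex_less X X' \<or> level_colex_less X' X"
    using totalp_onD[OF total, of X X'] inv F by (auto simp: mem_inversions_iff)
  then show False using not_less inv by (auto simp: mem_inversions_iff)
qed

lemma shadow_inversion_subset_if_Min_notin:
  assumes S: "finite S" and inv: "level_colex_inversions S F = {(X, Y)}"
    and F: "F \<subseteq> Pow S" and Y: "Min S \<in> S - Y"
  shows "shadow {Y} \<subseteq> shadow F"
proof
  interpret finite_strict_linorder level_colex_less "Pow S"
    using S by (rule level_colex_strict_linorder)
  have XY: "X \<in> F" "X \<in> Pow S" "Y \<in> Pow S" "level_colex_less Y X"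
    using inversions_eq_singletonD[OF inv] F by auto
  fix U assume "U \<in> shadow {Y}"
  then obtain j where j: "j \<notin> U" "insert j U = Y" by (auto simp: shadow_def)
  define Z where "Z = insert (Min S) U"
  have "j \<in> S" "U \<subseteq> S" "Min S \<notin> U" "Min S \<noteq> j" using j XY(3) Y by auto
  moreover have "Min S < j"
    using Min_le[OF S \<open>j \<in> S\<close>] \<open>Min S \<noteq> j\<close> by (rule le_neq_implies_less)
  ultimately have "level_colex_less Z Y"
    unfolding Z_def j(2)[symmetric] using j(1) finite_subset[OF _ S]
    by (intro level_colex_less_exchange) auto
  moreover have "Z \<in> Pow S" using Y \<open>U \<subseteq> S\<close> by (simp add: Z_def)
  ultimately have "level_colex_less Z X" using XY transp_onD[OF trans] by blast
  moreover have "(X, Z) \<notin> level_colex_inversions S F" using inv Y by (auto simp: Z_def)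
  ultimately have "Z \<in> F" using XY(1) \<open>Z \<in> Pow S\<close> by (simp add: mem_inversions_iff)
  then show "U \<in> shadow F" using \<open>Min S \<notin> U\<close> by (auto simp: shadow_def Z_def)
qed

lemma complementary_inversion_not_less_exchange:
  assumes S: "finite S" and inv: "level_colex_inversions S F = {(X, S - X)}"
    and F: "F \<subseteq> Pow S" and Min: "Min S \<in> S - X" and x: "x \<in> X"
  shows "\<not> level_colex_less (S - X) (insert (Min S) (X - {x}))"
proof
  define Z where "Z = insert (Min S) (X - {x})"
  assume "level_colex_less (S - X) (insert (Min S) (X - {x}))"
  then have less_Z: "level_colex_less (S - X) Z" by (simp add: Z_def)
  have X: "X \<in> F" "X \<subseteq> S" "S - X \<notin> F"
    using inversions_eq_singletonD[OF inv] F by auto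
  have "Min S < x" using Min S X(2) x by (metis DiffD2 Min_le le_neq_implies_less subsetD)
  then have "level_colex_less Z X"
    using level_colex_less_exchange[of "X - {x}" "Min S" x] Min x finite_subset[OF X(2) S]
    by (simp add: Z_def insert_absorb)
  moreover have "Z \<in> Pow S" using Min X(2) by (auto simp: Z_def)
  moreover have "(X, Z) \<notin> level_colex_inversions S F"
    using inv less_Z level_colex_less_irrefl by auto
  ultimately have "Z \<in> F" using X(1) by (auto simp: mem_inversions_iff)
  then have "(Z, S - X) \<in> level_colex_inversions S F"
    using less_Z X by (auto simp: mem_inversions_iff)
  then show False using inv Min by (auto simp: Z_def)
qed

lemma complementary_inversion_singletons:
  assumes S: "finite S" and inv: "level_colex_inversions S F = {(X, S - X)}"
    and F: "F \<subseteq> Pow S" and Min: "Min S \<in> S - X"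
  shows "X = {Max S}" "S - X = {Min S}"
proof -
  have X: "X \<subseteq> S" and less: "level_colex_less (S - X) X"
    using inversions_eq_singletonD[OF inv] F by auto
  have fin: "finite X" "finite (S - X)" using X S by (auto intro: finite_subset)
  note not_less_exchange = complementary_inversion_not_less_exchange[OF S inv F Min]
  have card_exchange: "card (insert (Min S) (X - {x})) = card X" if "x \<in> X" for x
    using that Min fin(1) by (simp add: card_Suc_Diff1 del: card_Diff_insert)
  have "X \<noteq> {}" using less by (auto simp: level_colex_less_def)
  then have "\<not> card (S - X) < card X"
    using not_less_exchange card_exchange level_colex_less_if_card by (metis ex_in_conv)
  then have card: "card (S - X) = card X" and Max: "Max S \<in> X"
    using less level_colex_less_complement_iff[OF S X] Min by auto
  have "x = Max S" if x: "x \<in> X" for x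
  proof (rule ccontr)
    assume "x \<noteq> Max S"
    moreover have "j \<notin> S" if "j > Max S" for j using that S Max_ge leD by blast
    ultimately have "level_colex_less (S - X) (insert (Min S) (X - {x}))"
      using Max Min X fin card card_exchange[OF x]
      by (subst level_colex_less_iff) (auto intro!: exI[of _ "Max S"])
    then show False using not_less_exchange x by blast
  qed
  then show "X = {Max S}" using Max by blast
  then have "card (S - X) = 1" using card by simp
  then show "S - X = {Min S}" using Min by (metis card_1_singletonE singletonD)
qed

lemma shadow_complementary_inversion_subset:
  assumes S: "finite S" and inv: "level_colex_inversions S F = {(X, S - X)}" and F: "F \<subseteq> Pow S"
  shows "shadow {S - X} \<subseteq> shadow F"
proof -
  have X: "X \<in> F" "X \<subseteq> S" "level_colex_less (S - X) X"
    using inversions_eq_singletonD[OF inv] F by auto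
  then have "S \<noteq> {}" using level_colex_less_irrefl by auto
  then have "Min S \<in> S" using S by simp
  show ?thesis
  proof (cases "Min S \<in> X")
    case True
    then show ?thesis
      using shadow_inversion_subset_if_Min_notin[OF S inv F] \<open>Min S \<in> S\<close> by simp
  next
    case False
    then have "Min S \<in> S - X" using \<open>Min S \<in> S\<close> by blast
    then have "shadow {S - X} = shadow {X}"
      using complementary_inversion_singletons[OF S inv F] by (metis shadow_singleton)
    also have "\<dots> \<subseteq> shadow F" using X(1) by (intro shadow_mono) simp
    finally show ?thesis .
  qed
qed

lemma card_shadow_compressed:
  assumes S: "finite S" and F: "F \<subseteq> Pow S"
    and compressed: "\<And>i. i \<in> S \<Longrightarrow> compression S i F = F"
  shows "card (shadow (level_colex_segment S (card F))) \<le> card (shadow F)"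
proof -
  interpret finite_strict_linorder level_colex_less "Pow S"
    using S by (rule level_colex_strict_linorder)
  show ?thesis
  proof (cases "level_colex_initial S F")
    case True
    then show ?thesis using initial_segment_eq_first_elements by simp
  next
    case False
    have compl: "Y = S - X" if "(X, Y) \<in> level_colex_inversions S F" for X Y
      using compressed_inversion_complementary[OF S F compressed that] .
    obtain X where X: "(X, S - X) \<in> level_colex_inversions S F"
      using False F compl by (fastforce simp: initial_segment_iff_no_inversions)
    then have inv: "level_colex_inversions S F = {(X, S - X)}"
      using compl complementary_inversion_unique[OF S F compl X] by fast
    define exchanged where "exchanged = insert (S - X) (F - {X})"
    have "X \<in> F" "S - X \<notin> F" using X by (auto simp: mem_inversions_iff)
    then have "card exchanged = card F"
      using finite_subset[OF F finite_carrier]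
      by (simp add: exchanged_def card_Suc_Diff1 del: card_Diff_insert)
    moreover have "level_colex_initial S exchanged"
      unfolding exchanged_def using F inv by (rule initial_segment_exchange_inversion)
    ultimately have "level_colex_segment S (card F) = exchanged"
      using initial_segment_eq_first_elements by metis
    moreover have "shadow exchanged \<subseteq> shadow F"
      using shadow_complementary_inversion_subset[OF S inv F] shadow_mono[of "F - {X}" F]
      unfolding exchanged_def shadow_insert[of _ "F - {X}"] by blast
    ultimately show ?thesis
      by (simp add: card_mono[OF finite_shadow[OF S F]])
  qed
qed

theorem card_shadow_level_colex_segment_le:
  assumes "finite S" "F \<subseteq> Pow S" "down_closed F"
  shows "card (shadow (level_colex_segment S (card F))) \<le> card (shadow F)"
  using assms
proof (induction S arbitrary: F rule: finite_psubset_induct)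
  case (psubset S)
  from psubset.prems show ?case
  proof (induction F rule: measure_induct_rule[of "sum (level_colex_rank S)"])
    case (less F)
    show ?case
    proof (cases "\<forall>i\<in>S. compression S i F = F")
      case True
      then show ?thesis
        by (intro card_shadow_compressed psubset.hyps less.prems(1)) simp
    next
      case False
      then obtain i where i: "i \<in> S" "compression S i F \<noteq> F" by blast
      note compression = psubset.hyps i(1) less.prems(1)
      have segment_le: "card (shadow (level_colex_segment (S - {i}) (card E))) \<le> card (shadow E)"
        if "E \<subseteq> Pow (S - {i})" "down_closed E" for E
        using psubset.IH[of "S - {i}" E] i(1) that by blast
      have "card (shadow (compression S i F)) \<le> card (shadow F)"
        using segment_le[OF deletion_subset_Pow down_closed_deletion]
          segment_le[OF link_subset_Pow down_closed_link] less.prems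
        by (intro card_shadow_compression_le[OF compression])
          (simp_all add: deletion_compression link_compression)
      moreover have "card (shadow (level_colex_segment S (card (compression S i F))))
          \<le> card (shadow (compression S i F))"
        by (intro less.IH sum_rank_compression_less[OF compression i(2)] compression_subset_Pow i(1)
            down_closed_compression[OF compression] less.prems(2))
      ultimately show ?thesis by (simp add: card_compression[OF compression])
    qed
  qed
qed

theorem theorem4:
  fixes n :: nat and A I :: "nat set set"
  assumes "downset n A"
    and "I = level_colex_first n (card A)"
  shows "num_maximal A \<le> num_maximal I"
proof -
  let ?S = "{1..n}"
  have A: "A \<subseteq> Pow ?S" "down_closed A"
    using assms(1) by (auto simp: downset_def down_closed_def boolean_lattice_def)
  have I: "I = level_colex_segment ?S (card A)"
    using assms(2)
    by (simp add: level_colex_first_def first_elements_def rank_on_def boolean_lattice_def)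
  have "down_closed I"
    unfolding I
    by (intro level_colex_initial_down_closed[of ?S] level_colex_initial_segment) simp_all
  moreover have "finite A" "finite I"
    using A(1) first_elements_subset[of level_colex_less "Pow ?S"] I by (auto intro: finite_subset)
  moreover have "card I = card A"
    using card_level_colex_segment[OF _ A(1)] by (simp add: I)
  moreover have "card (shadow I) \<le> card (shadow A)"
    using card_shadow_level_colex_segment_le[OF _ A] by (simp add: I)
  ultimately show ?thesis
    using A(2) by (simp add: num_maximal_down_closed)
qed

end
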